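(* Fix a precision $(p.q)$ with $p\ge p'$, $q\ge q'$, a step size $\rho\in\mathbb{R}_{(p.q)}$ with $0<\rho\le L^{-1}$, and a tolerance $\hat\epsilon>0$, $\hat\epsilon\in\mathbb{R}_{(p.q)}$. Let $\Omega>0$ satisfy $\|\rho\nabla f(\hat x)-\hat g_\rho(\hat x)\|\le\Omega$ for all $\hat x\in\mathcal{X}_{(p.q)}$ and all problems in $\mathbb{P}$. Let $\delta,\omega,\Theta>0$ be scalars such that, for all problems in $\mathbb{P}$ and all $\hat x^k\in\mathcal{X}_{(p.q)}$ with $\hat d^2(\hat x^k)<\hat\epsilon$, $$\|\hat x^k-\mathcal{T}_\rho(\hat x^k)\|\le\delta,\qquad \|\hat x^{k+1}-\mathcal{T}_\rho(\hat x^k)\|\le\omega,\qquad \|\hat x^k-\hat x^{k+1}\|\le\Theta,$$ where $\hat x^{k+1}=\min\{u,\max\{\ell,\hat x^k-\hat g_\rho(\hat x^k)\}\}$. Let $\{\hat x^k\}$ be the sequence generated by the fixed-point proximal gradient method applied to a problem of $\mathbb{P}$ with starting point $\hat x^0\in\hat{\mathcal{X}}^0_{(p.q)}$, let $x^*$ and $f^*$ be the optimal solution and optimal value of that problem, and let $T=\sigma^{-1}(\rho^{-1}+L)$. Then, if $\hat d^2(\hat x^k)<\hat\epsilon$, (i) $\|\hat x^{k+1}-x^*\|\le\omega+\delta T$; (ii) $f(\hat x^{k+1})-f^*\le\rho^{-1}\left((\Theta+\Omega)(\omega+\delta T)+\frac12\Theta^2\right)$.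
   Context: Fixed-point sets. $\mathbb{R}^n_{(p.q)}\subset\mathbb{R}^n$ is the set of vectors each of whose components has integer and fractional parts representable with $p$ and $q$ binary digits respectively (plus a sign), i.e. components of the form $m2^{-q}$ with $m\in\mathbb{Z}$, $|m|<2^{p+q}$; similarly for matrices. For $\mathcal{C}\subseteq\mathbb{R}^n$, $\mathcal{C}_{(p.q)}=\mathcal{C}\cap\mathbb{R}^n_{(p.q)}$. $\|\cdot\|$ is the Euclidean norm. Problem family. $\mathbb{P}$ is the family of strongly convex box-constrained QPs $\min_{x\in\mathbb{R}^n} f(x)=\frac12x^\top Qx+c^\top x$ subject to $\ell\le x\le u$ (componentwise), with $Q$ symmetric positive definite in a compact set $\mathbb{Q}\subset\mathbb{R}^{n\times n}_{(p'.q')}$, and $c,\ell,u\in\mathbb{R}^n_{(p'.q')}$ satisfying $c_{\min}\le c\le c_{\max}$, $\ell_{\min}\le\ell\le\ell_{\max}$, $u_{\min}\le u\le u_{\max}$ for fixed bounds in $\mathbb{R}^n_{(p'.q')}$, and $\ell\le u$. For a given problem, $\mathcal{X}=\{x\in\mathbb{R}^n:\ell\le x\le u\}$, $x^*$ is its unique minimizer and $f^*=f(x^* )$. $L,\sigma>0$ are constants valid for every problem in $\mathbb{P}$ such that for all $x,y\in\mathbb{R}^n$: $f(x)\le f(y)+\langle\nabla f(y),x-y\rangle+\frac L2\|x-y\|^2$ and $f(x)\ge f(y)+\langle\nabla f(y),x-y\rangle+\frac\sigma2\|x-y\|^2$. Exact operator. $\mathcal{T}_\rho:\mathcal{X}\to\mathcal{X}$,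 $\mathcal{T}_\rho(x)=\arg\min_{y\in\mathcal{X}}\frac12\|y-(x-\rho\nabla f(x))\|^2=\min\{u,\max\{\ell,x-\rho\nabla f(x)\}\}$ (componentwise). Fixed-point proximal gradient method. Given $\hat x^0\in\hat{\mathcal{X}}^0_{(p.q)}\subseteq\mathcal{X}_{(p.q)}$ (set of possible initial points), iterate for $k=0,1,2,\dots$: $\hat x^{k+1}=\min\{u,\max\{\ell,\hat x^k-\hat g_\rho(\hat x^k)\}\}$, until $\hat d^2(\hat x^k)<\hat\epsilon$ (or a maximum number of iterations is reached). Here $\hat g_\rho:\mathcal{X}_{(p.q)}\to\mathbb{R}^n_{(p.q)}$ (depending on the problem) returns the result of evaluating $\rho\nabla f(\cdot)$ in fixed-point arithmetic, and $\hat d^2:\mathcal{X}_{(p.q)}\to\mathbb{R}_{(p.q)}\cap[0,\infty)$ maps $\hat x^k$ to the result of evaluating $\|\hat x^{k+1}-\hat x^k\|^2$ in fixed-point arithmetic; both may be treated as arbitrary such maps subject to the stated bounds. It is assumed throughout that no overflow occurs, so that the subtraction, min and max in the update are exact and $\hat x^k\in\mathcal{X}_{(p.q)}$ for all $k$. *)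

theory Defs
  imports "HOL-Analysis.Analysis"
begin

text \<open>Fixed-point numbers with \<open>p\<close> integer bits, \<open>q\<close> fractional bits and a sign.\<close>

definition fp :: "nat \<Rightarrow> nat \<Rightarrow> real set" where
  "fp p q = {r. \<exists>m::int. \<bar>m\<bar> < 2 ^ (p + q) \<and> r = of_int m / 2 ^ q}"

definition fp_vec :: "nat \<Rightarrow> nat \<Rightarrow> (real ^ 'n) set" where
  "fp_vec p q = {x. \<forall>i. x $ i \<in> fp p q}"

definition fp_mat :: "nat \<Rightarrow> nat \<Rightarrow> (real ^ 'n ^ 'n) set" where
  "fp_mat p q = {A. \<forall>i j. A $ i $ j \<in> fp p q}"

definition sym_pos_def :: "real ^ 'n ^ 'n \<Rightarrow> bool" where
  "sym_pos_def A \<longleftrightarrow> transpose A = A \<and> (\<forall>x. x \<noteq> 0 \<longrightarrow> x \<bullet> (A *v x) > 0)"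

definition gradient :: "('a::real_inner \<Rightarrow> real) \<Rightarrow> 'a \<Rightarrow> 'a" where
  "gradient f x = (THE D. GDERIV f x :> D)"

record ('n::finite) qp =
  qp_Q :: "real ^ 'n ^ 'n"
  qp_c :: "real ^ 'n"
  qp_l :: "real ^ 'n"
  qp_u :: "real ^ 'n"

definition objective :: "'n::finite qp \<Rightarrow> real ^ 'n \<Rightarrow> real" where
  "objective P x = 1 / 2 * (x \<bullet> (qp_Q P *v x)) + qp_c P \<bullet> x"

text \<open>The order on vectors is componentwise, so the interval below is a box.\<close>

definition feasible :: "'n::finite qp \<Rightarrow> (real ^ 'n) set" where
  "feasible P = {qp_l P .. qp_u P}"

definition feasible_fp :: "nat \<Rightarrow> nat \<Rightarrow> 'n::finite qp \<Rightarrow> (real ^ 'n) set" where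
  "feasible_fp p q P = feasible P \<inter> fp_vec p q"

definition opt_sol :: "'n::finite qp \<Rightarrow> real ^ 'n" where
  "opt_sol P = arg_min_on (objective P) (feasible P)"

definition opt_val :: "'n::finite qp \<Rightarrow> real" where
  "opt_val P = objective P (opt_sol P)"

definition qp_family ::
  "nat \<Rightarrow> nat \<Rightarrow> (real ^ 'n ^ 'n) set \<Rightarrow> real ^ 'n \<Rightarrow> real ^ 'n \<Rightarrow> real ^ 'n \<Rightarrow> real ^ 'n
    \<Rightarrow> real ^ 'n \<Rightarrow> real ^ 'n \<Rightarrow> 'n::finite qp set" where
  "qp_family p q QQ cmin cmax lmin lmax umin umax =
    {P. qp_Q P \<in> QQ \<and> sym_pos_def (qp_Q P)
      \<and> qp_c P \<in> fp_vec p q \<and> qp_l P \<in> fp_vec p q \<and> qp_u P \<in> fp_vec p q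
      \<and> cmin \<le> qp_c P \<and> qp_c P \<le> cmax
      \<and> lmin \<le> qp_l P \<and> qp_l P \<le> lmax
      \<and> umin \<le> qp_u P \<and> qp_u P \<le> umax
      \<and> qp_l P \<le> qp_u P}"

definition exact_op :: "real \<Rightarrow> 'n::finite qp \<Rightarrow> real ^ 'n \<Rightarrow> real ^ 'n" where
  "exact_op \<rho> P x =
    arg_min_on (\<lambda>y. 1 / 2 * (norm (y - (x - \<rho> *\<^sub>R gradient (objective P) x)))\<^sup>2) (feasible P)"

text \<open>Componentwise truncation to the box. The polymorphic \<open>min\<close> and \<open>max\<close> applied to
  whole vectors would not be componentwise, since the order is only partial.\<close>

definition box_clip :: "'n::finite qp \<Rightarrow> real ^ 'n \<Rightarrow> real ^ 'n" where
  "box_clip P z = (\<chi> i. min (qp_u P $ i) (max (qp_l P $ i) (z $ i)))"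

definition fp_step ::
  "('n::finite qp \<Rightarrow> real ^ 'n \<Rightarrow> real ^ 'n) \<Rightarrow> 'n qp \<Rightarrow> real ^ 'n \<Rightarrow> real ^ 'n" where
  "fp_step g P x = box_clip P (x - g P x)"

text \<open>The iteration is continued past the stopping test; a run of the method that
  stops after evaluating the test at iterate \<open>k\<close> has computed the iterates up to \<open>k + 1\<close>.\<close>

primrec fp_iter ::
  "('n::finite qp \<Rightarrow> real ^ 'n \<Rightarrow> real ^ 'n) \<Rightarrow> 'n qp \<Rightarrow> real ^ 'n \<Rightarrow> nat \<Rightarrow> real ^ 'n" where
  "fp_iter g P x0 0 = x0"
| "fp_iter g P x0 (Suc k) = fp_step g P (fp_iter g P x0 k)"

lemma GDERIV_objective:
  assumes "transpose (qp_Q P) = qp_Q P"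
  shows "GDERIV (objective P) x :> qp_Q P *v x + qp_c P"
proof -
  have sym: "v \<bullet> (qp_Q P *v w) = (qp_Q P *v v) \<bullet> w" for v w
    using dot_lmul_matrix[of v "qp_Q P" w] transpose_matrix_vector[of "qp_Q P" v]
    unfolding assms by simp
  have lin: "bounded_linear ((*v) (qp_Q P))"
    by (rule matrix_vector_mul_bounded_linear)
  have "(objective P has_derivative
      (\<lambda>h. 1 / 2 * (x \<bullet> (qp_Q P *v h) + h \<bullet> (qp_Q P *v x)) + qp_c P \<bullet> h)) (at x)"
    unfolding objective_def[abs_def]
    by (auto intro!: derivative_eq_intros bounded_linear.has_derivative[OF lin])
  moreover have "(\<lambda>h. 1 / 2 * (x \<bullet> (qp_Q P *v h) + h \<bullet> (qp_Q P *v x)) + qp_c P \<bullet> h)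
      = (\<lambda>h. h \<bullet> (qp_Q P *v x + qp_c P))"
  proof
    fix h
    have "x \<bullet> (qp_Q P *v h) = h \<bullet> (qp_Q P *v x)"
      by (simp only: sym[of x h] inner_commute[of _ h])
    then show "1 / 2 * (x \<bullet> (qp_Q P *v h) + h \<bullet> (qp_Q P *v x)) + qp_c P \<bullet> h
        = h \<bullet> (qp_Q P *v x + qp_c P)"
      by (simp add: inner_add_right inner_commute[of "qp_c P" h])
  qed
  ultimately show ?thesis
    unfolding gderiv_def by simp
qed

lemma gradient_objective:
  assumes "transpose (qp_Q P) = qp_Q P"
  shows "gradient (objective P) x = qp_Q P *v x + qp_c P"
proof -
  have "D = D'" if "GDERIV (objective P) x :> D" "GDERIV (objective P) x :> D'" for D D'
  proof -
    have "(\<lambda>h. h \<bullet> D) = (\<lambda>h. h \<bullet> D')"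
      using that unfolding gderiv_def by (rule has_derivative_unique)
    then have "\<forall>h. h \<bullet> D = h \<bullet> D'" by (simp add: fun_eq_iff)
    then show ?thesis by (simp only: vector_eq_ldot)
  qed
  then show ?thesis
    unfolding gradient_def using GDERIV_objective[OF assms] by (intro the_equality) auto
qed

lemma exact_op_eq_box_clip:
  assumes "qp_l P \<le> qp_u P"
  shows "exact_op \<rho> P x = box_clip P (x - \<rho> *\<^sub>R gradient (objective P) x)"
proof -
  define z where "z = x - \<rho> *\<^sub>R gradient (objective P) x"
  define w where "w = box_clip P z"
  have lu: "qp_l P $ i \<le> qp_u P $ i" for i
    using assms by (simp add: less_eq_vec_def)
  have w: "w \<in> feasible P"
    using lu by (auto simp: w_def box_clip_def feasible_def less_eq_vec_def min_def max_def)
  have strict: "(norm (w - z))\<^sup>2 < (norm (y - z))\<^sup>2" if y: "y \<in> feasible P" "y \<noteq> w" for y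
  proof -
    have yb: "qp_l P $ i \<le> y $ i" "y $ i \<le> qp_u P $ i" for i
      using y by (auto simp: feasible_def less_eq_vec_def)
    have var: "(w $ i - z $ i) * (y $ i - w $ i) \<ge> 0" for i
      using yb[of i] lu[of i]
      by (auto simp: w_def box_clip_def min_def max_def zero_le_mult_iff)
    have "(w - z) \<bullet> (y - w) \<ge> 0"
      unfolding inner_vec_def using var by (auto intro!: sum_nonneg)
    moreover have "(norm (y - z))\<^sup>2 = (norm (w - z))\<^sup>2 + 2 * ((w - z) \<bullet> (y - w)) + (norm (y - w))\<^sup>2"
      unfolding power2_norm_eq_inner by (simp add: inner_diff inner_commute algebra_simps)
    moreover have "(norm (y - w))\<^sup>2 > 0" using y by simp
    ultimately show ?thesis by linarith
  qed
  have "arg_min_on (\<lambda>y. 1 / 2 * (norm (y - z))\<^sup>2) (feasible P) = w"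
    unfolding arg_min_on_def arg_min_def
  proof (rule some_equality)
    show "is_arg_min (\<lambda>y. 1 / 2 * (norm (y - z))\<^sup>2) (\<lambda>y. y \<in> feasible P) w"
      unfolding is_arg_min_def using w strict by force
    show "y = w" if "is_arg_min (\<lambda>y. 1 / 2 * (norm (y - z))\<^sup>2) (\<lambda>y. y \<in> feasible P) y" for y
      using that w strict[of y] unfolding is_arg_min_def by force
  qed
  then show ?thesis by (simp add: exact_op_def z_def w_def)
qed

end

theory Submission
  imports Defs
begin

text \<open>With \<open>t = exact_op \<rho> P x\<close>, the variational inequalities of the projection defining \<open>t\<close>
  and of the minimizer \<open>x\<^sup>*\<close>, tested against each other, give
  \<open>\<sigma> \<parallel>t - x\<^sup>*\<parallel>\<^sup>2 \<le> (\<rho>\<^sup>-\<^sup>1 + L) \<parallel>x - t\<parallel> \<parallel>t - x\<^sup>*\<parallel>\<close>, which is (i) up to a triangle inequality.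
  For (ii), the inexact step is itself an exact projection of \<open>x - g P x\<close>, so its own variational
  inequality applies, and \<open>\<rho> \<nabla>f(x)\<close> may be replaced by \<open>g P x\<close> at the cost of \<open>\<Omega>\<close>.\<close>

lemma box_clip_feasible:
  assumes "qp_l P \<le> qp_u P"
  shows "box_clip P z \<in> feasible P"
  using assms by (auto simp: box_clip_def feasible_def less_eq_vec_def min_def max_def)

text \<open>Holds coordinate by coordinate: the residual \<open>z $ i - box_clip P z $ i\<close>
  vanishes unless clipping occurs; then it points out of the interval at the active bound, while
  \<open>y $ i - box_clip P z $ i\<close> points inward.\<close>

lemma box_clip_variational:
  assumes "y \<in> feasible P"
  shows "(z - box_clip P z) \<bullet> (y - box_clip P z) \<le> 0"
proof -
  have "(z $ i - box_clip P z $ i) * (y $ i - box_clip P z $ i) \<le> 0" for i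
  proof -
    have "qp_l P $ i \<le> y $ i" "y $ i \<le> qp_u P $ i"
      using assms by (auto simp: feasible_def less_eq_vec_def)
    then show ?thesis
      by (auto simp: box_clip_def min_def max_def mult_le_0_iff)
  qed
  then show ?thesis
    unfolding inner_vec_def by (auto intro!: sum_nonpos)
qed

text \<open>\<open>opt_sol\<close> is a Hilbert choice, informative only once some minimizer exists.
  Compactness of the box and continuity of the objective supply one.\<close>

lemma opt_sol_is_arg_min:
  assumes "transpose (qp_Q P) = qp_Q P" and "qp_l P \<le> qp_u P"
  shows "opt_sol P \<in> feasible P"
    and "y \<in> feasible P \<Longrightarrow> objective P (opt_sol P) \<le> objective P y"
proof -
  have "compact (feasible P)"
    unfolding feasible_def by (simp flip: interval_cbox)
  moreover have "feasible P \<noteq> {}"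
    using assms(2) by (auto simp: feasible_def)
  moreover have "continuous_on (feasible P) (objective P)"
    using GDERIV_objective[OF assms(1)] has_derivative_continuous
    unfolding gderiv_def by (blast intro: continuous_at_imp_continuous_on)
  ultimately obtain s where "s \<in> feasible P" "\<forall>y\<in>feasible P. objective P s \<le> objective P y"
    using continuous_attains_inf by blast
  then have "is_arg_min (objective P) (\<lambda>y. y \<in> feasible P) s"
    by (auto simp: is_arg_min_linorder)
  then have "is_arg_min (objective P) (\<lambda>y. y \<in> feasible P) (opt_sol P)"
    unfolding opt_sol_def arg_min_on_def arg_min_def by (rule someI)
  then show "opt_sol P \<in> feasible P"
    and "y \<in> feasible P \<Longrightarrow> objective P (opt_sol P) \<le> objective P y"
    by (auto simp: is_arg_min_linorder)
qed

text \<open>Divide by t and let t tend to 0 from the right.\<close>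

lemma nonneg_if_nonneg_linear_plus_quadratic:
  fixes a b :: real
  assumes "\<And>t. 0 < t \<Longrightarrow> t \<le> 1 \<Longrightarrow> 0 \<le> t * a + t\<^sup>2 * b"
  shows "0 \<le> a"
proof (rule tendsto_lowerbound[where F = "at_right 0"])
  show "((\<lambda>t. a + t * b) \<longlongrightarrow> a) (at_right 0)"
    by (auto intro!: tendsto_eq_intros)
  have "0 \<le> a + t * b" if "0 < t" "t \<le> 1" for t
  proof -
    have "0 \<le> t * (a + t * b)"
      using assms[OF that] by (simp add: power2_eq_square algebra_simps)
    then show ?thesis
      using that by (simp add: zero_le_mult_iff)
  qed
  then show "\<forall>\<^sub>F t in at_right 0. 0 \<le> a + t * b"
    by (auto simp: eventually_at_right_field intro!: exI[of _ 1])
qed simp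

text \<open>First-order optimality: moving from s a fraction t towards y stays in S, so the value
  cannot drop. The quadratic upper model at s bounds the change by a linear plus a quadratic term in
  t, and the linear one dominates for small t.\<close>

lemma minimizer_variational:
  fixes f :: "'a::real_inner \<Rightarrow> real"
  assumes "convex S" "s \<in> S" "y \<in> S"
    and min: "\<And>z. z \<in> S \<Longrightarrow> f s \<le> f z"
    and smooth: "\<And>z. f z \<le> f s + G \<bullet> (z - s) + L / 2 * (norm (z - s))\<^sup>2"
  shows "0 \<le> G \<bullet> (y - s)"
proof (rule nonneg_if_nonneg_linear_plus_quadratic)
  fix t :: real
  assume "0 < t" "t \<le> 1"
  then have "s + t *\<^sub>R (y - s) \<in> S"
    using convexD_alt[OF assms(1-3), of t] by (simp add: algebra_simps)
  then have "f s \<le> f (s + t *\<^sub>R (y - s))"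
    by (rule min)
  with smooth[of "s + t *\<^sub>R (y - s)"]
  show "0 \<le> t * (G \<bullet> (y - s)) + t\<^sup>2 * (L / 2 * (norm (y - s))\<^sup>2)"
    by (simp add: power_mult_distrib mult_ac)
qed

text \<open>Serves as the Lipschitz bound for the gradient of the quadratic objective, obtained from
  the form alone by a Cauchy-Schwarz argument.\<close>

lemma quadratic_form_polar_bound:
  fixes A :: "real ^ 'n ^ 'n"
  assumes "transpose A = A"
    and nonneg: "\<And>v. 0 \<le> v \<bullet> (A *v v)"
    and upper: "\<And>v. v \<bullet> (A *v v) \<le> L * (norm v)\<^sup>2"
  shows "a \<bullet> (A *v b) \<le> L * norm a * norm b"
proof (cases "a = 0 \<or> b = 0")
  case False
  define \<alpha> \<beta> where "\<alpha> = norm a" and "\<beta> = norm b"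
  have pos: "\<alpha> > 0" "\<beta> > 0"
    using False by (auto simp: \<alpha>_def \<beta>_def)
  have sym: "b \<bullet> (A *v a) = a \<bullet> (A *v b)"
    using dot_lmul_matrix[of b A a] transpose_matrix_vector[of A b] assms(1)
    by (simp add: inner_commute)
  \<comment> \<open>The weights give both scaled vectors the same norm \<alpha> * \<beta>, so the
    two square terms get equal bounds and the cross term carries the claim.\<close>
  have "0 \<le> (\<beta> *\<^sub>R a - \<alpha> *\<^sub>R b) \<bullet> (A *v (\<beta> *\<^sub>R a - \<alpha> *\<^sub>R b))"
    by (rule nonneg)
  also have "\<dots> = \<beta>\<^sup>2 * (a \<bullet> (A *v a)) + \<alpha>\<^sup>2 * (b \<bullet> (A *v b)) - 2 * \<alpha> * \<beta> * (a \<bullet> (A *v b))"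
    using sym by (simp add: matrix_vector_mult_diff_distrib matrix_vector_mult_scaleR
        inner_diff power2_eq_square algebra_simps)
  also have "\<dots> \<le> \<beta>\<^sup>2 * (L * \<alpha>\<^sup>2) + \<alpha>\<^sup>2 * (L * \<beta>\<^sup>2) - 2 * \<alpha> * \<beta> * (a \<bullet> (A *v b))"
    using upper[of a] upper[of b]
    by (intro diff_right_mono add_mono mult_left_mono) (auto simp: \<alpha>_def \<beta>_def)
  finally have "(2 * \<alpha> * \<beta>) * (a \<bullet> (A *v b)) \<le> (2 * \<alpha> * \<beta>) * (L * \<alpha> * \<beta>)"
    by (simp add: power2_eq_square algebra_simps)
  then show ?thesis
    using pos by (simp add: \<alpha>_def \<beta>_def)
qed auto

theorem theorem3:
  fixes p q p' q' :: nat
    and QQ :: "(real ^ 'n::finite ^ 'n) set"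
    and cmin cmax lmin lmax umin umax :: "real ^ 'n"
    and PP :: "'n qp set"
    and L \<sigma> \<rho> \<epsilon> \<Omega> \<delta> \<omega> \<Theta> T :: real
    and g :: "'n qp \<Rightarrow> real ^ 'n \<Rightarrow> real ^ 'n"
    and d2 :: "'n qp \<Rightarrow> real ^ 'n \<Rightarrow> real"
    and X0 :: "'n qp \<Rightarrow> (real ^ 'n) set"
    and P :: "'n qp" and x0 :: "real ^ 'n" and k :: nat
  assumes QQ: "compact QQ" "QQ \<subseteq> fp_mat p' q'"
    and bounds: "cmin \<in> fp_vec p' q'" "cmax \<in> fp_vec p' q'" "lmin \<in> fp_vec p' q'"
      "lmax \<in> fp_vec p' q'" "umin \<in> fp_vec p' q'" "umax \<in> fp_vec p' q'"
    and PP: "PP = qp_family p' q' QQ cmin cmax lmin lmax umin umax"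
    and L_pos: "L > 0" and \<sigma>_pos: "\<sigma> > 0"
    and smooth: "\<And>R x y. R \<in> PP \<Longrightarrow>
      objective R x \<le> objective R y + gradient (objective R) y \<bullet> (x - y) + L / 2 * (norm (x - y))\<^sup>2"
    and strongly_convex: "\<And>R x y. R \<in> PP \<Longrightarrow>
      objective R x \<ge> objective R y + gradient (objective R) y \<bullet> (x - y) + \<sigma> / 2 * (norm (x - y))\<^sup>2"
    and precision: "p \<ge> p'" "q \<ge> q'"
    and \<rho>: "\<rho> \<in> fp p q" "0 < \<rho>" "\<rho> \<le> inverse L"
    and \<epsilon>: "\<epsilon> \<in> fp p q" "\<epsilon> > 0"
    and g_fp: "\<And>R x. R \<in> PP \<Longrightarrow> x \<in> feasible_fp p q R \<Longrightarrow> g R x \<in> fp_vec p q"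
    and d2_fp: "\<And>R x. R \<in> PP \<Longrightarrow> x \<in> feasible_fp p q R \<Longrightarrow> d2 R x \<in> fp p q \<inter> {0..}"
    and \<Omega>_pos: "\<Omega> > 0"
    and \<Omega>: "\<And>R x. R \<in> PP \<Longrightarrow> x \<in> feasible_fp p q R \<Longrightarrow>
      norm (\<rho> *\<^sub>R gradient (objective R) x - g R x) \<le> \<Omega>"
    and pos: "\<delta> > 0" "\<omega> > 0" "\<Theta> > 0"
    and \<delta>: "\<And>R x. R \<in> PP \<Longrightarrow> x \<in> feasible_fp p q R \<Longrightarrow> d2 R x < \<epsilon> \<Longrightarrow>
      norm (x - exact_op \<rho> R x) \<le> \<delta>"
    and \<omega>: "\<And>R x. R \<in> PP \<Longrightarrow> x \<in> feasible_fp p q R \<Longrightarrow> d2 R x < \<epsilon> \<Longrightarrow>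
      norm (fp_step g R x - exact_op \<rho> R x) \<le> \<omega>"
    and \<Theta>: "\<And>R x. R \<in> PP \<Longrightarrow> x \<in> feasible_fp p q R \<Longrightarrow> d2 R x < \<epsilon> \<Longrightarrow>
      norm (x - fp_step g R x) \<le> \<Theta>"
    and X0: "\<And>R. R \<in> PP \<Longrightarrow> X0 R \<subseteq> feasible_fp p q R"
    and P: "P \<in> PP"
    and x0: "x0 \<in> X0 P"
    and no_overflow: "\<And>j. fp_iter g P x0 j \<in> feasible_fp p q P"
    and T: "T = inverse \<sigma> * (inverse \<rho> + L)"
    and stop: "d2 P (fp_iter g P x0 k) < \<epsilon>"
  shows "norm (fp_iter g P x0 (Suc k) - opt_sol P) \<le> \<omega> + \<delta> * T
    \<and> objective P (fp_iter g P x0 (Suc k)) - opt_val P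
      \<le> inverse \<rho> * ((\<Theta> + \<Omega>) * (\<omega> + \<delta> * T) + 1 / 2 * \<Theta>\<^sup>2)"
proof -
  \<comment> \<open>The test is passed at iterate k but the claim concerns iterate k + 1: all error
    bounds are instantiated at x, and y is the iterate to be estimated.\<close>
  define x where "x = fp_iter g P x0 k"
  define y where "y = fp_step g P x"
  define t where "t = exact_op \<rho> P x"
  define s where "s = opt_sol P"
  define G where "G v = qp_Q P *v v + qp_c P" for v
  have trans: "transpose (qp_Q P) = qp_Q P" and pd: "\<And>v. v \<noteq> 0 \<Longrightarrow> v \<bullet> (qp_Q P *v v) > 0"
    and lu: "qp_l P \<le> qp_u P"
    using P unfolding PP qp_family_def sym_pos_def_def by auto
  have grad: "gradient (objective P) v = G v" for v
    unfolding G_def by (rule gradient_objective[OF trans])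
  note smooth' = smooth[OF P, unfolded grad]
  note sconv' = strongly_convex[OF P, unfolded grad]
  have Gdiff: "G v - G w = qp_Q P *v (v - w)" for v w
    by (simp add: G_def matrix_vector_mult_diff_distrib)
  have xF: "x \<in> feasible_fp p q P"
    unfolding x_def by (rule no_overflow)
  have stop': "d2 P x < \<epsilon>"
    unfolding x_def by (rule stop)
  have \<delta>': "norm (x - t) \<le> \<delta>" and \<omega>': "norm (y - t) \<le> \<omega>" and \<Theta>': "norm (x - y) \<le> \<Theta>"
    and \<Omega>': "norm (\<rho> *\<^sub>R G x - g P x) \<le> \<Omega>"
    using \<delta>[OF P xF stop'] \<omega>[OF P xF stop'] \<Theta>[OF P xF stop'] \<Omega>[OF P xF]
    by (auto simp: t_def y_def grad)
  have t_clip: "t = box_clip P (x - \<rho> *\<^sub>R G x)"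
    unfolding t_def exact_op_eq_box_clip[OF lu] grad ..
  have y_clip: "y = box_clip P (x - g P x)"
    by (simp add: y_def fp_step_def)
  have sF: "s \<in> feasible P" and s_min: "\<And>z. z \<in> feasible P \<Longrightarrow> objective P s \<le> objective P z"
    unfolding s_def using opt_sol_is_arg_min[OF trans lu] by auto
  have tF: "t \<in> feasible P"
    unfolding t_clip by (rule box_clip_feasible[OF lu])
  have "convex (feasible P)"
    unfolding feasible_def by (simp flip: interval_cbox)
  then have s_var: "0 \<le> G s \<bullet> (t - s)"
    using sF tF s_min smooth' by (rule minimizer_variational)
  \<comment> \<open>Adding the smoothness inequalities between v and 0 in both directions cancels
    the objective values and leaves only gradients.\<close>
  have upper: "v \<bullet> (qp_Q P *v v) \<le> L * (norm v)\<^sup>2" for v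
  proof -
    have "G v \<bullet> v - G 0 \<bullet> v \<le> L * (norm v)\<^sup>2"
      using smooth'[of v 0] smooth'[of 0 v] by simp
    then show ?thesis
      using Gdiff[of v 0] by (simp add: inner_commute flip: inner_diff_right)
  qed
  have nonneg: "0 \<le> v \<bullet> (qp_Q P *v v)" for v
    using pd[of v] by (cases "v = 0") auto
  have "(G t - G x) \<bullet> (t - s) \<le> L * norm (t - s) * norm (t - x)"
    using quadratic_form_polar_bound[OF trans nonneg upper, of "t - s" "t - x"]
    by (simp add: Gdiff inner_commute)
  moreover have "G x \<bullet> (t - s) \<le> inverse \<rho> * (norm (x - t) * norm (t - s))"
  proof -
    have "\<rho> * (G x \<bullet> (t - s)) \<le> (x - t) \<bullet> (t - s)"
      using box_clip_variational[OF sF, of "x - \<rho> *\<^sub>R G x", folded t_clip]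
      by (simp add: inner_diff algebra_simps)
    also have "\<dots> \<le> norm (x - t) * norm (t - s)"
      by (rule norm_cauchy_schwarz)
    finally show ?thesis
      using \<rho>(2) by (simp add: field_simps)
  qed
  \<comment> \<open>Strong monotonicity of the gradient: the strong convexity inequalities in both
    directions are added.\<close>
  moreover have "\<sigma> * (norm (t - s))\<^sup>2 \<le> (G t - G s) \<bullet> (t - s)"
    using sconv'[of t s] sconv'[of s t]
    by (simp add: norm_minus_commute inner_diff algebra_simps)
  \<comment> \<open>Split \<open>G t - G s\<close> as \<open>(G t - G x) + G x - G s\<close>; by
    \<open>s_var\<close> the last term contributes nothing positive.\<close>
  ultimately have "\<sigma> * (norm (t - s))\<^sup>2 \<le> (inverse \<rho> + L) * norm (x - t) * norm (t - s)"
    using s_var by (simp add: norm_minus_commute inner_diff_left algebra_simps)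
  then have "\<sigma> * norm (t - s) \<le> (inverse \<rho> + L) * norm (x - t)"
    using \<rho>(2) L_pos by (cases "t = s") (auto simp: power2_eq_square)
  also have "\<dots> \<le> (inverse \<rho> + L) * \<delta>"
    using \<delta>' \<rho>(2) L_pos by (intro mult_left_mono) auto
  finally have ts: "norm (t - s) \<le> \<delta> * T"
    using \<sigma>_pos by (simp add: T field_simps)
  have "norm (y - s) \<le> norm (y - t) + norm (t - s)"
    using norm_triangle_ineq[of "y - t" "t - s"] by simp
  with \<omega>' ts have i: "norm (y - s) \<le> \<omega> + \<delta> * T"
    by linarith

  have "\<rho> * (G x \<bullet> (y - s)) = (\<rho> *\<^sub>R G x - g P x) \<bullet> (y - s) + g P x \<bullet> (y - s)"
    by (simp add: inner_diff_left)
  \<comment> \<open>The projection inequality for y is tested at s; it trades the computed gradient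
    for the step x - y, which \<Theta> controls.\<close>
  also have "g P x \<bullet> (y - s) \<le> (x - y) \<bullet> (y - s)"
    using box_clip_variational[OF sF, of "x - g P x", folded y_clip]
    by (simp add: inner_diff algebra_simps)
  also have "(\<rho> *\<^sub>R G x - g P x) \<bullet> (y - s) \<le> \<Omega> * norm (y - s)"
    using norm_cauchy_schwarz \<Omega>' by (rule order_trans[OF _ mult_right_mono]) auto
  also have "(x - y) \<bullet> (y - s) \<le> \<Theta> * norm (y - s)"
    using norm_cauchy_schwarz \<Theta>' by (rule order_trans[OF _ mult_right_mono]) auto
  also have "\<Omega> * norm (y - s) + \<Theta> * norm (y - s) = (\<Theta> + \<Omega>) * norm (y - s)"
    by (simp add: algebra_simps)
  also have "\<dots> \<le> (\<Theta> + \<Omega>) * (\<omega> + \<delta> * T)"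
    using i pos \<Omega>_pos by (intro mult_left_mono) auto
  finally have lin: "G x \<bullet> (y - s) \<le> inverse \<rho> * ((\<Theta> + \<Omega>) * (\<omega> + \<delta> * T))"
    using \<rho>(2) by (simp add: field_simps)
  \<comment> \<open>The step-size restriction enters here: it turns the smoothness constant of the
    quadratic term into \<open>inverse \<rho>\<close>, the common factor in (ii).\<close>
  have "L \<le> inverse \<rho>"
    using \<rho>(2,3) L_pos by (simp add: field_simps)
  moreover have "(norm (y - x))\<^sup>2 \<le> \<Theta>\<^sup>2"
    using \<Theta>' by (intro power_mono) (auto simp: norm_minus_commute)
  ultimately have "L * (norm (y - x))\<^sup>2 \<le> inverse \<rho> * \<Theta>\<^sup>2"
    using \<rho>(2) by (intro mult_mono) auto
  \<comment> \<open>Go from s to y through x: smoothness at x bounds the value at y from above,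
    convexity at x bounds the value at s from below, and the value at x cancels.\<close>
  moreover have "objective P y - objective P s \<le> G x \<bullet> (y - s) + L / 2 * (norm (y - x))\<^sup>2"
  proof -
    have "0 \<le> \<sigma> / 2 * (norm (s - x))\<^sup>2"
      using \<sigma>_pos by simp
    then show ?thesis
      using smooth'[of y x] sconv'[of x s] by (simp add: inner_diff_right)
  qed
  ultimately have "objective P y - objective P s
      \<le> inverse \<rho> * ((\<Theta> + \<Omega>) * (\<omega> + \<delta> * T) + 1 / 2 * \<Theta>\<^sup>2)"
    using lin unfolding distrib_left by linarith
  with i show ?thesis
    by (simp add: opt_val_def s_def x_def y_def)
qed

end
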